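(* Let $R=(r_0,r_1,r_2)$ be the initial positions of three robots in general position in the plane and let $P=(p_0,p_1,p_2)$ be a triangular pattern, scaled to have perimeter $1$. Let $Q=(q_0,q_1,q_2)$ be the positions the robots move to after running the following algorithm: for each $i\in\{0,1,2\}$ (indices modulo $3$), let $t_i$ be the point such that $\angle t_i r_{i+1} r_{i-1}=\angle p_i p_{i+1}p_{i-1}$ and $\angle r_{i+1}r_{i-1}t_i=\angle p_{i+1}p_{i-1}p_i$; robot $i$ moves from $r_i$ a distance $r= d(r_i,t_i)\,d(p_{i+1},p_{i-1})$ along the straight line toward $t_i$, ending at $q_i$. Then $Q$ is an optimal formation under rigid similarity: $Q$ is rigidly similar to $P$, and for every sequence $F=(f_0,f_1,f_2)$ rigidly similar to $P$, $$\max_{0\le i\le 2} d(r_i,q_i)\ \le\ \max_{0\le i\le 2} d(r_i,f_i).$$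
   Context: $d(\cdot,\cdot)$ is Euclidean distance. A triangular pattern is a sequence of three distinct points. A sequence $Q$ is rigidly similar to $P$ if some translation, rotation, and/or uniform scaling of $P$ (no reflection, no permutation) equals $Q$ entry by entry. The angles in the algorithm are directed, i.e. $t_i$ is the unique point such that the triple $(t_i,r_{i+1},r_{i-1})$ is obtained from $(p_i,p_{i+1},p_{i-1})$ by a translation, rotation, and/or uniform scaling (no reflection).
   Formalization: Uniform scaling by factor 0 is admitted, since Q can collapse to a single point (P equilateral, R equilateral of opposite orientation), where the claim fails for positive factors; whenever the q_i are not all equal, a strictly positive factor is proved. *)

theory Defs
  imports "HOL-Analysis.Analysis"
begin

text \<open>
  The plane is \<^typ>\<open>complex\<close>, so that \<^const>\<open>dist\<close> is the Euclidean distance, and a sequence of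
  three points is a function on the cyclic index type \<^typ>\<open>3\<close>, whose arithmetic is modulo 3;
  the indices 0, 1, 2 are exactly the elements of \<^typ>\<open>3\<close>.

  A composition of translations, rotations and uniform scalings, in any order, is a map
  \<open>z \<mapsto> s * cis \<theta> * z + b\<close>, where \<open>s\<close> is the product of the scaling factors.
\<close>

definition similar_with :: "real \<Rightarrow> (3 \<Rightarrow> complex) \<Rightarrow> (3 \<Rightarrow> complex) \<Rightarrow> bool" where
  "similar_with s p q \<longleftrightarrow> (\<exists>\<theta> b. \<forall>i. q i = of_real s * cis \<theta> * p i + b)"

text \<open>
  The factor 0 (all points collapse to one) has to be admitted. If p is the equilateral triangle
  with \<open>p i = cis (2 * pi * i / 3) / (3 * sqrt 3)\<close> and \<open>r i = cis (- 2 * pi * i / 3)\<close>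
  is an equilateral triangle of the opposite orientation, then every formation similar to p, of any
  factor, has maximal displacement at least 1, and only the collapsed formation at the centre
  attains 1. Over positive factors alone there would be no optimal formation for this r.
\<close>

definition rigidly_similar :: "(3 \<Rightarrow> complex) \<Rightarrow> (3 \<Rightarrow> complex) \<Rightarrow> bool" where
  "rigidly_similar p q \<longleftrightarrow> (\<exists>s\<ge>0. similar_with s p q)"

definition perimeter :: "(3 \<Rightarrow> complex) \<Rightarrow> real" where
  "perimeter p = (\<Sum>i\<in>UNIV. dist (p i) (p (i + 1)))"

text \<open>
  \<open>r(i := t)\<close> is the triple with entries t at i, \<open>r (i + 1)\<close> at \<open>i + 1\<close>, and \<open>r (i - 1)\<close> at
  \<open>i - 1\<close>. The point t is unique for injective p; for injective r the scaling factor is then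
  automatically positive. The directed angles of the construction are encoded this way because
  they do not determine t when p is collinear.
\<close>

definition target :: "(3 \<Rightarrow> complex) \<Rightarrow> (3 \<Rightarrow> complex) \<Rightarrow> 3 \<Rightarrow> complex" where
  "target p r i = (THE t. rigidly_similar p (r(i := t)))"

text \<open>For \<open>target p r i = r i\<close> the distance moved is 0, in agreement with \<open>sgn 0 = 0\<close>.\<close>

definition destination :: "(3 \<Rightarrow> complex) \<Rightarrow> (3 \<Rightarrow> complex) \<Rightarrow> 3 \<Rightarrow> complex" where
  "destination p r i =
     r i + (dist (r i) (target p r i) * dist (p (i + 1)) (p (i - 1))) *\<^sub>R sgn (target p r i - r i)"

end

theory Submission imports Defs begin

text \<open>
  Put \<open>c i = p (i + 1) - p (i - 1)\<close>. A triple \<open>f\<close> is rigidly similar to \<open>p\<close> iff the linear form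
  \<open>L f = (\<Sum>i. c i * f i)\<close> vanishes. Changing only entry \<open>i\<close> of \<open>r\<close> to reach the kernel of \<open>L\<close>
  gives \<open>t i = r i - L r / c i\<close>, so every robot moves the same distance \<open>cmod (L r)\<close>, and entry
  \<open>i\<close> contributes \<open>- cmod (c i) * L r\<close> to the change of \<open>L\<close>. As \<open>(\<Sum>i. cmod (c i)) = 1\<close>, the final
  positions lie in the kernel. Conversely \<open>L f = 0\<close> gives
  \<open>cmod (L r) = cmod (L (r - f)) \<le> (MAX i. dist (r i) (f i))\<close>.
\<close>

definition side :: "(3 \<Rightarrow> complex) \<Rightarrow> 3 \<Rightarrow> complex" where
  "side p i = p (i + 1) - p (i - 1)"

text \<open>Up to sign this is the determinant with rows \<open>(1, 1, 1)\<close>, \<open>p\<close>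
  and \<open>f\<close>.\<close>

definition defect :: "(3 \<Rightarrow> complex) \<Rightarrow> (3 \<Rightarrow> complex) \<Rightarrow> complex" where
  "defect p f = (\<Sum>i\<in>UNIV. side p i * f i)"

lemma sum_mod3: "(\<Sum>i\<in>UNIV. f (i::3)) = f 0 + f 1 + f 2"
  for f :: "3 \<Rightarrow> 'a::comm_monoid_add"
proof -
  \<comment> \<open>\<open>sum_3\<close> lists the indices as 1, 2, 3, and 3 equals 0 in this
    type.\<close>
  have "f 3 = f 0"
    by (rule arg_cong[of _ _ f]) simp
  then show ?thesis
    unfolding sum_3 by (simp add: ac_simps)
qed

lemma all_mod3: "(\<forall>i::3. P i) \<longleftrightarrow> P 0 \<and> P 1 \<and> P 2"
proof -
  have "P 3 = P 0"
    by (rule arg_cong[of _ _ P]) simp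
  then show ?thesis
    unfolding forall_3 by blast
qed

lemma side_mod3: "side p 0 = p 1 - p 2" "side p 1 = p 2 - p 0" "side p 2 = p 0 - p 1"
proof -
  have "p (- 1) = p 2" "p 3 = p 0"
    by (rule arg_cong[of _ _ p], simp)+
  then show "side p 0 = p 1 - p 2" "side p 1 = p 2 - p 0" "side p 2 = p 0 - p 1"
    by (simp_all add: side_def)
qed

lemma side_nonzero:
  assumes "inj p"
  shows "side p i \<noteq> 0"
proof -
  have "p 0 \<noteq> p 1" "p 1 \<noteq> p 2" "p 2 \<noteq> p 0"
    using assms by (simp_all add: inj_eq)
  then have "\<forall>i. side p i \<noteq> 0"
    by (auto simp: all_mod3 side_mod3)
  then show ?thesis ..
qed

text \<open>Since \<open>side p i\<close> is the edge opposite entry \<open>i\<close>, both sums run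
  over the same three edges, in different orders.\<close>

lemma perimeter_eq_sum_side: "perimeter p = (\<Sum>i\<in>UNIV. cmod (side p i))"
proof -
  have "p 3 = p 0"
    by (rule arg_cong[of _ _ p]) simp
  then show ?thesis
    by (simp add: perimeter_def sum_mod3 side_mod3 dist_norm norm_minus_commute)
qed

text \<open>Polar form: the modulus of \<open>a\<close> is the scaling factor and its argument the
  angle; \<open>a = 0\<close> is the collapsed case.\<close>

lemma rigidly_similar_iff_affine: "rigidly_similar p f \<longleftrightarrow> (\<exists>a b. \<forall>i. f i = a * p i + b)"
proof
  assume "\<exists>a b. \<forall>i. f i = a * p i + b"
  then obtain a b where f: "\<And>i. f i = a * p i + b"
    by blast
  have "a = of_real (cmod a) * cis (Arg a)"
    using rcis_cmod_Arg[of a] by (simp add: rcis_def)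
  then have "similar_with (cmod a) p f"
    unfolding similar_with_def using f by metis
  then show "rigidly_similar p f"
    unfolding rigidly_similar_def by (meson norm_ge_zero)
qed (auto simp: rigidly_similar_def similar_with_def)

lemma rigidly_similar_iff_defect:
  assumes "inj p"
  shows "rigidly_similar p f \<longleftrightarrow> defect p f = 0"
proof
  assume "rigidly_similar p f"
  then show "defect p f = 0"
    by (auto simp: rigidly_similar_iff_affine defect_def sum_mod3 side_mod3 algebra_simps)
next
  assume "defect p f = 0"
  then have D: "(p 1 - p 2) * f 0 + (p 2 - p 0) * f 1 + (p 0 - p 1) * f 2 = 0"
    by (simp add: defect_def sum_mod3 side_mod3)
  have ne: "p 1 - p 0 \<noteq> 0"
    using assms by (simp add: inj_eq)
  \<comment> \<open>The only multiplier carrying \<open>p 1 - p 0\<close> to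
    \<open>f 1 - f 0\<close>; entry 2 remains to be checked.\<close>
  define a where "a = (f 1 - f 0) / (p 1 - p 0)"
  have a: "a * (p 1 - p 0) = f 1 - f 0"
    using ne by (simp add: a_def)
  \<comment> \<open>As the sides sum to 0, \<open>D\<close> amounts to
    \<open>(p 2 - p 0) * (f 1 - f 0) = (p 1 - p 0) * (f 2 - f 0)\<close>.\<close>
  have "(p 1 - p 0) * (f 2 - f 0) = (p 1 - p 0) * (a * (p 2 - p 0))"
    using D a by algebra
  then have a2: "a * (p 2 - p 0) = f 2 - f 0"
    using ne by simp
  have "\<forall>i. f i = a * p i + (f 0 - a * p 0)"
    using a a2 by (simp add: all_mod3 algebra_simps)
  then show "rigidly_similar p f"
    unfolding rigidly_similar_iff_affine by blast
qed

lemma defect_fun_upd: "defect p (r(i := t)) = defect p r + side p i * (t - r i)"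
proof -
  have "\<forall>i. defect p (r(i := t)) = defect p r + side p i * (t - r i)"
    unfolding all_mod3 by (simp add: defect_def sum_mod3 algebra_simps)
  then show ?thesis ..
qed

lemma target_eq:
  assumes "inj p"
  shows "target p r i = r i - defect p r / side p i"
  unfolding target_def
proof (rule the_equality)
  show "rigidly_similar p (r(i := r i - defect p r / side p i))"
    using side_nonzero[OF assms, of i]
    by (simp add: rigidly_similar_iff_defect[OF assms] defect_fun_upd)
next
  fix t
  assume "rigidly_similar p (r(i := t))"
  then have "defect p r + side p i * (t - r i) = 0"
    by (simp add: rigidly_similar_iff_defect[OF assms] defect_fun_upd)
  then show "t = r i - defect p r / side p i"
    using side_nonzero[OF assms, of i] by (simp add: field_simps)
qed

text \<open>Distance times \<open>sgn\<close> restores the full displacement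
  \<open>- defect p r / side p i\<close>, even when it is 0, so only the factor
  \<open>cmod (side p i)\<close> is left over.\<close>

lemma destination_eq:
  assumes "inj p"
  shows "destination p r i = r i - of_real (cmod (side p i)) * defect p r / side p i"
  using side_nonzero[OF assms, of i]
  by (simp add: destination_def target_eq[OF assms] dist_norm norm_divide
      side_def[symmetric] sgn_eq scaleR_conv_of_real)

lemma dist_destination:
  assumes "inj p"
  shows "dist (r i) (destination p r i) = cmod (defect p r)"
  using side_nonzero[OF assms, of i]
  by (simp add: destination_eq[OF assms] dist_norm norm_divide norm_mult)

lemma defect_destination:
  assumes "inj p" and "perimeter p = 1"
  shows "defect p (destination p r) = 0"
proof -
  have "side p i * destination p r i = side p i * r i - of_real (cmod (side p i)) * defect p r" for i
    using side_nonzero[OF assms(1), of i]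
    by (simp add: destination_eq[OF assms(1)] algebra_simps)
  then have "defect p (destination p r) = defect p r - of_real (perimeter p) * defect p r"
    unfolding defect_def[of p "destination p r"] perimeter_eq_sum_side
    by (simp add: sum_subtractf sum_distrib_right defect_def)
  then show ?thesis
    using assms(2) by simp
qed

text \<open>The displacements \<open>r i - f i\<close> enter with weights whose moduli sum to the
  perimeter 1, so the triangle inequality bounds the combination by the largest of them.\<close>

lemma defect_le_max_dist:
  assumes "inj p" and "perimeter p = 1" and "rigidly_similar p f"
  shows "cmod (defect p r) \<le> (MAX i. dist (r i) (f i))"
proof -
  let ?M = "MAX i. dist (r i) (f i)"
  have "defect p f = 0"
    using assms(1,3) by (simp add: rigidly_similar_iff_defect)
  then have "defect p r = (\<Sum>i\<in>UNIV. side p i * (r i - f i))"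
    by (simp add: defect_def right_diff_distrib sum_subtractf)
  also have "cmod \<dots> \<le> (\<Sum>i\<in>UNIV. cmod (side p i) * ?M)"
    by (intro sum_norm_le) (auto simp: norm_mult dist_norm[symmetric] intro!: mult_left_mono)
  also have "\<dots> = perimeter p * ?M"
    by (simp add: perimeter_eq_sum_side sum_distrib_right)
  finally show ?thesis
    using assms(2) by simp
qed

theorem theorem6:
  fixes p r q :: "3 \<Rightarrow> complex"
  assumes "\<not> collinear (range r)"
    and "inj p"
    and "perimeter p = 1"
    and "\<And>i. q i = destination p r i"
  shows "rigidly_similar p q
    \<and> ((\<exists>i j. q i \<noteq> q j) \<longrightarrow> (\<exists>s>0. similar_with s p q))
    \<and> (\<forall>f. rigidly_similar p f \<longrightarrow>
          (MAX i. dist (r i) (q i)) \<le> (MAX i. dist (r i) (f i)))"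
proof (intro conjI impI allI)
  have q: "q = destination p r"
    using assms(4) by blast
  show similar: "rigidly_similar p q"
    using assms(2,3) by (simp add: q rigidly_similar_iff_defect defect_destination)
  show "\<exists>s>0. similar_with s p q" if "\<exists>i j. q i \<noteq> q j"
  proof -
    obtain s where s: "s \<ge> 0" "similar_with s p q"
      using similar unfolding rigidly_similar_def by blast
    \<comment> \<open>Factor 0 would send all entries of \<open>p\<close> to the same point.\<close>
    have "s \<noteq> 0"
      using that s(2) by (auto simp: similar_with_def)
    then show ?thesis
      using s by (metis order_le_less)
  qed
  show "(MAX i. dist (r i) (q i)) \<le> (MAX i. dist (r i) (f i))" if "rigidly_similar p f" for f
    \<comment> \<open>The left maximum is taken over the constant
      \<open>cmod (defect p r)\<close>.\<close>
    using defect_le_max_dist[OF assms(2,3) that] by (simp add: q dist_destination[OF assms(2)])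
qed

end
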